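(* In the setting of the context, let $\theta\in\mathbb{R}^{n_x}$. Consider the robust policy synthesis problem (P) minimize $J(\mathbf{H},\mathbf{h})$ over $(\mathbf{H},\mathbf{h})\in\mathcal{H}\times\mathbb{R}^{Nn_u}$ subject to: for all $\mathbf{w}\in\mathbf{W}_{\mathrm{set}}$ the constraints (U), (X) and (S) of the context hold; and the mixed-integer quadratic program (Q) minimize $J(\mathbf{H},\mathbf{h})$ over $(\mathbf{H},\mathbf{h})\in\mathcal{H}\times\mathbb{R}^{Nn_u}$, $\delta\in\Delta$, $\boldsymbol{\lambda}\in\mathbb{R}_{\ge0}^{m^\varphi n_v}$ subject to $$\overline{\mathbf{V}}^\top\boldsymbol{\lambda}+G^H\mathbf{B}\mathbf{h}+G^\theta\mathbf{A}\theta+G^\delta\delta+g\le 0,\qquad \overline{\mathbf{W}}^\top\boldsymbol{\lambda}=\left(I_{m^\varphi}\otimes\begin{bmatrix}\mathbf{H}&0\end{bmatrix}^\top\right)\mathbf{G}^\top+\mathbf{g}^\top,$$ where $\otimes$ is the Kronecker product, $\overline{\mathbf{V}}=\mathrm{diag}(\mathbf{v},\ldots,\mathbf{v})$ and $\overline{\mathbf{W}}=\mathrm{diag}(\mathbf{W},\ldots,\mathbf{W})$ are block diagonal with $m^\varphi$ blocks, $\mathbf{G}=\begin{bmatrix}G^H_{1\bullet}\mathbf{B}&\cdots&G^H_{m^\varphi\bullet}\mathbf{B}\end{bmatrix}$ and $\mathbf{g}=\begin{bmatrix}G^w_{1\bullet}&\cdots&G^w_{m^\varphi\bullet}\end{bmatrix}$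 are row vectors, and $M_{i\bullet}$ denotes the $i$-th row of a matrix $M$. Then for any solution of (Q), its components $\mathbf{H}^\star,\mathbf{h}^\star$ form a feasible (possibly suboptimal) solution of (P).
   Context: System and stacked notation. $A\in\mathbb{R}^{n_x\times n_x}$, $B\in\mathbb{R}^{n_x\times n_u}$; the system is $x_{k+1}=Ax_k+Bu_k$ with initial state $x_0=\theta\in\mathbb{R}^{n_x}$. $N\ge 1$ is the planning horizon. $\mathbf{x}=(x_0,\ldots,x_N)\in\mathbb{R}^{(N+1)n_x}$, $\mathbf{u}=(u_0,\ldots,u_{N-1})\in\mathbb{R}^{Nn_u}$, $\mathbf{w}=(w_0,\ldots,w_N)\in\mathbb{R}^{(N+1)n_w}$ are stacked column vectors. $\mathbf{A}\in\mathbb{R}^{(N+1)n_x\times n_x}$ and $\mathbf{B}\in\mathbb{R}^{(N+1)n_x\times Nn_u}$ are the block matrices such that $\mathbf{x}=\mathbf{A}x_0+\mathbf{B}\mathbf{u}$: the $k$-th block row ($k=0,\ldots,N$) of $\mathbf{A}$ is $A^k$, and the block of $\mathbf{B}$ in block row $k\in\{0,\dots,N\}$ and block column $j\in\{0,\dots,N-1\}$ is $A^{k-1-j}B$ if $j\le k-1$ and $0$ otherwise. Disturbances. $\mathbf{W}_{\mathrm{set}}=\{\mathbf{w}\in\mathbb{R}^{(N+1)n_w}: \mathbf{W}\mathbf{w}\le\mathbf{v}\}$ is a closed and bounded polyhedron, with $\mathbf{W}\in\mathbb{R}^{n_v\times(N+1)n_w}$, $\mathbf{v}\in\mathbb{R}^{n_v}$.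 Vector inequalities are componentwise. Policies. $\mathcal{H}$ is the set of matrices $\mathbf{H}\in\mathbb{R}^{Nn_u\times Nn_w}$ that are block lower triangular with blocks $H_{i,j}\in\mathbb{R}^{n_u\times n_w}$ ($H_{i,j}=0$ for $j>i$), and $\mathbf{h}\in\mathbb{R}^{Nn_u}$. The causal affine disturbance feedback policy is $\mathbf{u}=\begin{bmatrix}\mathbf{H}&0\end{bmatrix}\mathbf{w}+\mathbf{h}$, where the zero block has $n_w$ columns. The resulting trajectory is $\mathbf{x}=\mathbf{A}\theta+\begin{bmatrix}\mathbf{B}\mathbf{H}&0\end{bmatrix}\mathbf{w}+\mathbf{B}\mathbf{h}$. The objective $J:\mathbb{R}^{Nn_u\times Nn_w}\times\mathbb{R}^{Nn_u}\to\mathbb{R}$ is a convex quadratic function. Specifications. $\varphi$ is a formula of the grammar $p\mid\lnot p\mid\phi\land\psi\mid\phi\lor\psi\mid\bigcirc\phi\mid\phi\,\mathcal{U}\,\psi\mid\phi\,\mathcal{R}\,\psi$ with atomic propositions $p\in\{p_1,\ldots,p_m\}$, each $p_i$ associated with a polyhedron $\mathcal{P}_i=\{(x,w)\in\mathbb{R}^{n_x+n_w}: P_i^x x\le P_i^w w+\rho_i\}$. For $\mathbf{z}_j^L=(z_j,\ldots,z_{j+L})$ with $z_k=(x_k,w_k)$: $\mathbf{z}_j^L\models p_i$ iff $z_j\in\mathcal{P}_i$; $\mathbf{z}_j^L\models\lnot p_i$ iff $z_j\notin\mathcal{P}_i$; $\land,\lor$ as usual; $\mathbf{z}_j^L\models\bigcirc\phi$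 iff $\mathbf{z}_{j+1}^{L-1}\models\phi$ (false if $L=0$); $\mathbf{z}_j^L\models\phi\,\mathcal{U}\,\psi$ iff there is $\hat\jmath\in\{0,\ldots,L-1\}$ with $\mathbf{z}_{j+\hat\jmath}^{L-\hat\jmath}\models\psi$ and $\mathbf{z}_{j+i}^{L-i}\models\phi$ for all $i\in\{0,\ldots,\hat\jmath-1\}$; $\mathbf{z}_j^L\models\phi\,\mathcal{R}\,\psi$ iff for all $\hat\jmath\in\{0,\ldots,L-1\}$, $\mathbf{z}_{j+\hat\jmath}^{L-\hat\jmath}\models\psi$ or there is $i\in\{0,\ldots,\hat\jmath-1\}$ with $\mathbf{z}_{j+i}^{L-i}\models\phi$. $(\mathbf{x},\mathbf{w})\models\varphi$ means $\mathbf{z}_0^N\models\varphi$. Constraints. $\mathcal{U}_{\mathrm{in}}\subseteq\mathbb{R}^{n_u}$ and $\mathcal{X}\subseteq\mathbb{R}^{n_x}$ are compact convex polyhedra. For given $(\mathbf{H},\mathbf{h},\theta)$ and $\mathbf{w}$, with $\mathbf{u},\mathbf{x}$ as given by the policy: (U) $u_k\in\mathcal{U}_{\mathrm{in}}$ for $k=0,\ldots,N-1$; (X) $x_{k+1}\in\mathcal{X}$ for $k=0,\ldots,N-1$; (S) $(\mathbf{x},\mathbf{w})\models\varphi$. Mixed-integer encoding (standing assumption). $\Delta=\mathbb{R}^{n_c}\times\{0,1\}^{n_b}$, and there are given matrices $G^H,G^w,G^\theta,G^\delta$ with $m^\varphi$ rows and of appropriate dimensions and a vector $g\in\mathbb{R}^{m^\varphi}$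 such that, with $$g^\varphi(\mathbf{H},\mathbf{h},\theta,\mathbf{w},\delta):=\left(G^H\begin{bmatrix}\mathbf{B}\mathbf{H}&0\end{bmatrix}+G^w\right)\mathbf{w}+G^H\mathbf{B}\mathbf{h}+G^\theta\mathbf{A}\theta+G^\delta\delta+g\in\mathbb{R}^{m^\varphi},$$ for every $(\mathbf{H},\mathbf{h},\theta)$ and every $\mathbf{w}\in\mathbf{W}_{\mathrm{set}}$: (U), (X), (S) all hold if and only if there exists $\delta\in\Delta$ with $g^\varphi(\mathbf{H},\mathbf{h},\theta,\mathbf{w},\delta)\le 0$. *)

theory Defs
  imports Complex_Main "Jordan_Normal_Form.Matrix"
begin

section \<open>Polyhedra and convexity in \<open>\<real>\<^sup>n\<close>, represented by \<^term>\<open>carrier_vec n\<close>\<close>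

text \<open>
  The order on \<^typ>\<open>real vec\<close> is the componentwise one (between vectors of equal dimension).
  The type carries no topology, so closedness and boundedness are spelled out: sequences converge
  componentwise, and \<open>sqrt (x \<bullet> x)\<close> is the Euclidean norm.
\<close>

definition polyhedron :: "real mat \<Rightarrow> real vec \<Rightarrow> real vec set" where
  "polyhedron F f = {x \<in> carrier_vec (dim_col F). F *\<^sub>v x \<le> f}"

definition closed_vecs :: "nat \<Rightarrow> real vec set \<Rightarrow> bool" where
  "closed_vecs n S \<longleftrightarrow>
     (\<forall>X x. (\<forall>k::nat. X k \<in> S) \<and> x \<in> carrier_vec n \<and> (\<forall>i<n. (\<lambda>k. X k $ i) \<longlonglongrightarrow> x $ i) \<longrightarrow> x \<in> S)"

definition bounded_vecs :: "real vec set \<Rightarrow> bool" where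
  "bounded_vecs S \<longleftrightarrow> (\<exists>M. \<forall>x\<in>S. sqrt (x \<bullet> x) \<le> M)"

definition convex_vecs :: "real vec set \<Rightarrow> bool" where
  "convex_vecs S \<longleftrightarrow>
     (\<forall>x\<in>S. \<forall>y\<in>S. \<forall>t. 0 \<le> t \<and> t \<le> 1 \<longrightarrow> t \<cdot>\<^sub>v x + (1 - t) \<cdot>\<^sub>v y \<in> S)"

definition compact_convex_polyhedron :: "nat \<Rightarrow> real vec set \<Rightarrow> bool" where
  "compact_convex_polyhedron n S \<longleftrightarrow>
     (\<exists>r. \<exists>F \<in> carrier_mat r n. \<exists>f \<in> carrier_vec r. S = polyhedron F f) \<and>
     closed_vecs n S \<and> bounded_vecs S \<and> convex_vecs S"


section \<open>Block operations\<close>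

text \<open>The \<open>k\<close>-th block (counted from 0) of a vector stacked from blocks of length \<open>n\<close>.\<close>

definition block :: "nat \<Rightarrow> real vec \<Rightarrow> nat \<Rightarrow> real vec" where
  "block n x k = vec n (\<lambda>i. x $ (k * n + i))"

text \<open>\<open>append_zero_cols M n\<close> is the matrix \<open>[M 0]\<close> with \<open>n\<close> zero columns.\<close>

definition append_zero_cols :: "real mat \<Rightarrow> nat \<Rightarrow> real mat" where
  "append_zero_cols M n =
     four_block_mat M (0\<^sub>m (dim_row M) n) (0\<^sub>m 0 (dim_col M)) (0\<^sub>m 0 n)"

text \<open>The rows of \<open>M\<close> side by side, \<open>[M\<^sub>1 \<dots> M\<^sub>m]\<close>; a vector serves both as row and as column.\<close>

definition concat_rows :: "real mat \<Rightarrow> real vec" where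
  "concat_rows M = vec_of_list (concat (map list_of_vec (rows M)))"

definition kronecker :: "real mat \<Rightarrow> real mat \<Rightarrow> real mat" where
  "kronecker M K = mat (dim_row M * dim_row K) (dim_col M * dim_col K)
     (\<lambda>(i, j). M $$ (i div dim_row K, j div dim_col K) * K $$ (i mod dim_row K, j mod dim_col K))"

text \<open>\<open>diag(M,\<dots>,M)\<close> with \<open>m\<close> (not necessarily square) blocks.\<close>

definition block_diag :: "nat \<Rightarrow> real mat \<Rightarrow> real mat" where
  "block_diag m M = diag_block_mat (replicate m M)"


section \<open>Stacked dynamics and policies\<close>

definition stacked_A :: "nat \<Rightarrow> nat \<Rightarrow> real mat \<Rightarrow> real mat" where
  "stacked_A N nx A = mat ((N + 1) * nx) nx (\<lambda>(r, c). (A ^\<^sub>m (r div nx)) $$ (r mod nx, c))"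

definition stacked_B :: "nat \<Rightarrow> nat \<Rightarrow> nat \<Rightarrow> real mat \<Rightarrow> real mat \<Rightarrow> real mat" where
  "stacked_B N nx nu A B = mat ((N + 1) * nx) (N * nu)
     (\<lambda>(r, c). let k = r div nx; j = c div nu in
        if j < k then (A ^\<^sub>m (k - 1 - j) * B) $$ (r mod nx, c mod nu) else 0)"

definition causal_gains :: "nat \<Rightarrow> nat \<Rightarrow> nat \<Rightarrow> real mat set" where
  "causal_gains N nu nw = {H \<in> carrier_mat (N * nu) (N * nw).
     \<forall>r < N * nu. \<forall>c < N * nw. r div nu < c div nw \<longrightarrow> H $$ (r, c) = 0}"

definition policy_input :: "nat \<Rightarrow> real mat \<Rightarrow> real vec \<Rightarrow> real vec \<Rightarrow> real vec" where
  "policy_input nw H h w = append_zero_cols H nw *\<^sub>v w + h"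

definition policy_state ::
  "nat \<Rightarrow> nat \<Rightarrow> nat \<Rightarrow> nat \<Rightarrow> real mat \<Rightarrow> real mat \<Rightarrow>
   real mat \<Rightarrow> real vec \<Rightarrow> real vec \<Rightarrow> real vec \<Rightarrow> real vec" where
  "policy_state N nx nu nw A B H h \<theta> w =
     stacked_A N nx A *\<^sub>v \<theta> + append_zero_cols (stacked_B N nx nu A B * H) nw *\<^sub>v w
       + stacked_B N nx nu A B *\<^sub>v h"


section \<open>Specifications\<close>

datatype formula =
    Prop nat
  | NegProp nat
  | And formula formula
  | Or formula formula
  | Next formula
  | Until formula formula
  | Release formula formula

primrec props :: "formula \<Rightarrow> nat set" where
  "props (Prop i) = {i}"
| "props (NegProp i) = {i}"
| "props (And \<phi> \<psi>) = props \<phi> \<union> props \<psi>"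
| "props (Or \<phi> \<psi>) = props \<phi> \<union> props \<psi>"
| "props (Next \<phi>) = props \<phi>"
| "props (Until \<phi> \<psi>) = props \<phi> \<union> props \<psi>"
| "props (Release \<phi> \<psi>) = props \<phi> \<union> props \<psi>"

text \<open>
  \<open>sat P z j L \<phi>\<close> means that the segment \<open>(z\<^sub>j, \<dots>, z\<^bsub>j+L\<^esub>)\<close> satisfies \<open>\<phi>\<close>, where \<open>P i\<close> is the set
  associated with the \<open>i\<close>-th proposition. Until and release range over the offsets
  \<open>0, \<dots>, L - 1\<close>, so the last element of the segment is not among them.
\<close>

primrec sat :: "(nat \<Rightarrow> 'z set) \<Rightarrow> (nat \<Rightarrow> 'z) \<Rightarrow> nat \<Rightarrow> nat \<Rightarrow> formula \<Rightarrow> bool" where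
  "sat P z j L (Prop i) \<longleftrightarrow> z j \<in> P i"
| "sat P z j L (NegProp i) \<longleftrightarrow> z j \<notin> P i"
| "sat P z j L (And \<phi> \<psi>) \<longleftrightarrow> sat P z j L \<phi> \<and> sat P z j L \<psi>"
| "sat P z j L (Or \<phi> \<psi>) \<longleftrightarrow> sat P z j L \<phi> \<or> sat P z j L \<psi>"
| "sat P z j L (Next \<phi>) \<longleftrightarrow> L \<noteq> 0 \<and> sat P z (j + 1) (L - 1) \<phi>"
| "sat P z j L (Until \<phi> \<psi>) \<longleftrightarrow>
     (\<exists>l<L. sat P z (j + l) (L - l) \<psi> \<and> (\<forall>i<l. sat P z (j + i) (L - i) \<phi>))"
| "sat P z j L (Release \<phi> \<psi>) \<longleftrightarrow>
     (\<forall>l<L. sat P z (j + l) (L - l) \<psi> \<or> (\<exists>i<l. sat P z (j + i) (L - i) \<phi>))"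

definition prop_polyhedron :: "real mat \<Rightarrow> real mat \<Rightarrow> real vec \<Rightarrow> (real vec \<times> real vec) set" where
  "prop_polyhedron Px Pw \<rho> =
     {(x, w). x \<in> carrier_vec (dim_col Px) \<and> w \<in> carrier_vec (dim_col Pw) \<and>
              Px *\<^sub>v x \<le> Pw *\<^sub>v w + \<rho>}"


section \<open>Constraints and their mixed-integer encoding\<close>

definition constraints ::
  "nat \<Rightarrow> nat \<Rightarrow> nat \<Rightarrow> nat \<Rightarrow> real mat \<Rightarrow> real mat \<Rightarrow>
   real vec set \<Rightarrow> real vec set \<Rightarrow> (nat \<Rightarrow> (real vec \<times> real vec) set) \<Rightarrow> formula \<Rightarrow>
   real mat \<Rightarrow> real vec \<Rightarrow> real vec \<Rightarrow> real vec \<Rightarrow> bool" where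
  "constraints N nx nu nw A B Uin X P \<phi> H h \<theta> w \<longleftrightarrow>
     (let u = policy_input nw H h w;
          x = policy_state N nx nu nw A B H h \<theta> w
      in (\<forall>k<N. block nu u k \<in> Uin) \<and>
         (\<forall>k<N. block nx x (k + 1) \<in> X) \<and>
         sat P (\<lambda>k. (block nx x k, block nw w k)) 0 N \<phi>)"

text \<open>\<open>\<real>\<^bsup>nc\<^esup> \<times> {0,1}\<^bsup>nb\<^esup>\<close>, as stacked vectors.\<close>

definition mixed_binary :: "nat \<Rightarrow> nat \<Rightarrow> real vec set" where
  "mixed_binary nc nb = {\<delta> \<in> carrier_vec (nc + nb). \<forall>i\<in>{nc..<nc + nb}. \<delta> $ i \<in> {0, 1}}"

text \<open>In the following, \<open>AA\<close> and \<open>BB\<close> stand for the stacked matrices.\<close>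

definition encoding ::
  "nat \<Rightarrow> real mat \<Rightarrow> real mat \<Rightarrow>
   real mat \<Rightarrow> real mat \<Rightarrow> real mat \<Rightarrow> real mat \<Rightarrow> real vec \<Rightarrow>
   real mat \<Rightarrow> real vec \<Rightarrow> real vec \<Rightarrow> real vec \<Rightarrow> real vec \<Rightarrow> real vec" where
  "encoding nw AA BB GH Gw G\<theta> G\<delta> g H h \<theta> w \<delta> =
     (GH * append_zero_cols (BB * H) nw + Gw) *\<^sub>v w
       + (GH * BB) *\<^sub>v h + (G\<theta> * AA) *\<^sub>v \<theta> + G\<delta> *\<^sub>v \<delta> + g"


section \<open>Optimization problems\<close>

text \<open>Minimization of \<open>objective\<close> over \<open>feasible_set\<close>.\<close>

record 'a program =
  objective :: "'a \<Rightarrow> real"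
  feasible_set :: "'a set"

definition is_feasible :: "'a program \<Rightarrow> 'a \<Rightarrow> bool" where
  "is_feasible p z \<longleftrightarrow> z \<in> feasible_set p"

definition is_optimal :: "'a program \<Rightarrow> 'a \<Rightarrow> bool" where
  "is_optimal p z \<longleftrightarrow> is_arg_min (objective p) (is_feasible p) z"

text \<open>
  A convex quadratic function on \<open>\<real>\<^bsup>a\<times>b\<^esup> \<times> \<real>\<^bsup>a\<^esup>\<close>: a polynomial of degree at most two in the entries
  of its arguments, and convex.
\<close>

definition convex_quadratic :: "nat \<Rightarrow> nat \<Rightarrow> (real mat \<Rightarrow> real vec \<Rightarrow> real) \<Rightarrow> bool" where
  "convex_quadratic a b J \<longleftrightarrow>
     (\<exists>Q \<in> carrier_mat (a * b + a) (a * b + a). \<exists>q \<in> carrier_vec (a * b + a). \<exists>c.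
        \<forall>H \<in> carrier_mat a b. \<forall>h \<in> carrier_vec a.
          J H h = (let \<xi> = concat_rows H @\<^sub>v h in \<xi> \<bullet> (Q *\<^sub>v \<xi>) + q \<bullet> \<xi> + c)) \<and>
     (\<forall>H \<in> carrier_mat a b. \<forall>H' \<in> carrier_mat a b. \<forall>h \<in> carrier_vec a. \<forall>h' \<in> carrier_vec a. \<forall>t.
        0 \<le> t \<and> t \<le> 1 \<longrightarrow>
        J (t \<cdot>\<^sub>m H + (1 - t) \<cdot>\<^sub>m H') (t \<cdot>\<^sub>v h + (1 - t) \<cdot>\<^sub>v h') \<le> t * J H h + (1 - t) * J H' h')"

text \<open>
  The robust policy synthesis problem; \<open>C H h w\<close> are the constraints for the disturbance \<open>w\<close>.
\<close>

definition robust_program ::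
  "nat \<Rightarrow> nat \<Rightarrow> nat \<Rightarrow> (real mat \<Rightarrow> real vec \<Rightarrow> real) \<Rightarrow> real vec set \<Rightarrow>
   (real mat \<Rightarrow> real vec \<Rightarrow> real vec \<Rightarrow> bool) \<Rightarrow> (real mat \<times> real vec) program" where
  "robust_program N nu nw J Wset C =
     \<lparr>objective = (\<lambda>(H, h). J H h),
      feasible_set = {(H, h). H \<in> causal_gains N nu nw \<and> h \<in> carrier_vec (N * nu) \<and>
                              (\<forall>w \<in> Wset. C H h w)}\<rparr>"

definition dual_program ::
  "nat \<Rightarrow> nat \<Rightarrow> nat \<Rightarrow> (real mat \<Rightarrow> real vec \<Rightarrow> real) \<Rightarrow> real mat \<Rightarrow> real vec \<Rightarrow> nat \<Rightarrow> nat \<Rightarrow>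
   real mat \<Rightarrow> real mat \<Rightarrow>
   real mat \<Rightarrow> real mat \<Rightarrow> real mat \<Rightarrow> real mat \<Rightarrow> real vec \<Rightarrow>
   real vec \<Rightarrow> (real mat \<times> real vec \<times> real vec \<times> real vec) program" where
  "dual_program N nu nw J W v nc nb AA BB GH Gw G\<theta> G\<delta> g \<theta> =
     (let m = dim_row GH;
          nv = dim_vec v;
          Vbar = block_diag m (mat_of_cols nv [v]);
          Wbar = block_diag m W
      in \<lparr>objective = (\<lambda>(H, h, \<delta>, l). J H h),
          feasible_set = {(H, h, \<delta>, l).
            H \<in> causal_gains N nu nw \<and> h \<in> carrier_vec (N * nu) \<and>
            \<delta> \<in> mixed_binary nc nb \<and>
            l \<in> carrier_vec (m * nv) \<and> 0\<^sub>v (m * nv) \<le> l \<and>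
            transpose_mat Vbar *\<^sub>v l + (GH * BB) *\<^sub>v h + (G\<theta> * AA) *\<^sub>v \<theta> + G\<delta> *\<^sub>v \<delta> + g \<le> 0\<^sub>v m \<and>
            transpose_mat Wbar *\<^sub>v l =
              kronecker (1\<^sub>m m) (transpose_mat (append_zero_cols H nw)) *\<^sub>v concat_rows (GH * BB)
                + concat_rows Gw}\<rparr>)"

end

(* At a feasible point of the mixed-integer program, the i-th block of l is dual feasible for the
   linear program that maximizes the i-th row of the encoding over the disturbances. Weak duality
   bounds each row on all of Wset, so the single vector \<delta> certifies every disturbance. *)

theory Submission
  imports Defs
begin

section \<open>Blocks of stacked vectors and of concatenated rows\<close>

lemma block_index [simp]: "j < n \<Longrightarrow> block n x k $ j = x $ (k * n + j)"
  by (simp add: block_def)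

lemma dim_block [simp]: "dim_vec (block n x k) = n"
  by (simp add: block_def)

lemma block_carrier [simp]: "block n x k \<in> carrier_vec n"
  by (simp add: block_def)

lemma block_position_less:
  fixes i j m n :: nat
  assumes "i < m" "j < n"
  shows "i * n + j < m * n"
proof -
  have "i * n + j < Suc i * n" using assms(2) by simp
  also have "\<dots> \<le> m * n" using assms(1) by (intro mult_le_mono1 Suc_leI)
  finally show ?thesis .
qed

text \<open>A sum of vectors takes its dimension from the right summand, so it is the carrier of
  \<open>y\<close> that keeps the positions of block \<open>k\<close> in range.\<close>

lemma block_add:
  assumes "y \<in> carrier_vec (m * n)" "k < m"
  shows "block n (x + y) k = block n x k + block n y k"
  using assms by (intro eq_vecI) (auto simp: block_position_less)

lemma block_nonneg:
  assumes "0\<^sub>v (m * n) \<le> x" "k < m"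
  shows "0\<^sub>v n \<le> block n x k"
  using assms(1) block_position_less[OF assms(2), of _ n] by (auto simp: less_eq_vec_def)

lemma length_concat_equal:
  assumes "\<forall>ys\<in>set xss. length ys = n"
  shows "length (concat xss) = length xss * n"
  using assms by (induction xss) auto

lemma nth_concat_equal:
  assumes "\<forall>ys\<in>set xss. length ys = n" "i < length xss" "j < n"
  shows "concat xss ! (i * n + j) = xss ! i ! j"
  using assms by (induction xss arbitrary: i) (auto simp: nth_append nth_Cons split: nat.split)

lemma concat_rows_carrier:
  assumes "M \<in> carrier_mat m n"
  shows "concat_rows M \<in> carrier_vec (m * n)"
proof -
  have "length (concat (map list_of_vec (rows M))) = m * n"
    using assms by (subst length_concat_equal[where n = n]) (auto simp: rows_def)
  then show ?thesis by (intro carrier_vecI) (simp only: concat_rows_def dim_vec_of_list)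
qed

lemma block_concat_rows:
  assumes M: "M \<in> carrier_mat m n" and i: "i < m"
  shows "block n (concat_rows M) i = row M i"
proof (intro eq_vecI)
  fix j assume "j < dim_vec (row M i)"
  then have j: "j < n" using M by simp
  have "concat (map list_of_vec (rows M)) ! (i * n + j) = map list_of_vec (rows M) ! i ! j"
    using M i j by (intro nth_concat_equal) (auto simp: rows_def)
  also have "\<dots> = row M i $ j" using M i j by (simp add: list_of_vec_index)
  finally show "block n (concat_rows M) i $ j = row M i $ j"
    using j by (simp add: concat_rows_def vec_of_list_index)
qed (use M in auto)

section \<open>Kronecker products with an identity, and block diagonals\<close>

lemma kronecker_one_carrier:
  assumes "M \<in> carrier_mat r c"
  shows "kronecker (1\<^sub>m m) M \<in> carrier_mat (m * r) (m * c)"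
  using assms by (auto simp: kronecker_def)

lemma kronecker_one_index:
  assumes "M \<in> carrier_mat r c" "i < m * r" "j < m * c"
  shows "kronecker (1\<^sub>m m) M $$ (i, j) =
    (if i div r = j div c then M $$ (i mod r, j mod c) else 0)"
proof -
  have "i div r < m" "j div c < m" using assms by (auto simp: less_mult_imp_div_less)
  then show ?thesis using assms by (auto simp: kronecker_def)
qed

text \<open>Swapping row and column indices leaves the condition of equal block numbers intact. With
  this the transposed block diagonals of the dual constraints remain Kronecker products with an
  identity.\<close>

lemma transpose_kronecker_one:
  assumes M: "M \<in> carrier_mat r c"
  shows "transpose_mat (kronecker (1\<^sub>m m) M) = kronecker (1\<^sub>m m) (transpose_mat M)"
proof (intro eq_matI)
  fix i j
  assume "i < dim_row (kronecker (1\<^sub>m m) (transpose_mat M))"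
    and "j < dim_col (kronecker (1\<^sub>m m) (transpose_mat M))"
  then have ij: "i < m * c" "j < m * r" using M by (auto simp: kronecker_def)
  \<comment> \<open>An index in range rules out empty blocks, so the remainders are valid indices of
    \<open>M\<close>.\<close>
  then have "0 < c" "0 < r" by (auto intro: gr0I)
  then have "i mod c < c" "j mod r < r" by auto
  then show "transpose_mat (kronecker (1\<^sub>m m) M) $$ (i, j) = kronecker (1\<^sub>m m) (transpose_mat M) $$ (i, j)"
    using M ij kronecker_one_carrier[OF M, of m]
    by (auto simp: kronecker_one_index[OF M] kronecker_one_index[of "transpose_mat M" c r])
qed (use M in \<open>auto simp: kronecker_def\<close>)

text \<open>Brings both block diagonals to the form in which the policy enters the dual equation, so
  that one lemma on blocks of products serves all three.\<close>

lemma block_diag_eq_kronecker: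
  assumes M: "M \<in> carrier_mat r c"
  shows "block_diag m M = kronecker (1\<^sub>m m) M"
proof (induction m)
  case 0
  show ?case by (intro eq_matI) (auto simp: block_diag_def kronecker_def)
next
  case (Suc m)
  define K where "K = kronecker (1\<^sub>m m) M"
  have K: "K \<in> carrier_mat (m * r) (m * c)"
    unfolding K_def by (rule kronecker_one_carrier[OF M])
  have S: "block_diag (Suc m) M = four_block_mat M (0\<^sub>m r (m * c)) (0\<^sub>m (m * r) c) K"
    using Suc M K by (simp add: block_diag_def K_def Let_def)
  show ?case
  proof (intro eq_matI)
    fix i j
    assume "i < dim_row (kronecker (1\<^sub>m (Suc m)) M)" "j < dim_col (kronecker (1\<^sub>m (Suc m)) M)"
    then have ij: "i < Suc m * r" "j < Suc m * c" using M by (auto simp: kronecker_def)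
    then have pos: "0 < r" "0 < c" by (auto intro: gr0I)
    \<comment> \<open>Passing the leading block lowers the block number by one and keeps the
      position within the block; this matches the indices of the lower right corner \<open>K\<close>
      with the induction hypothesis.\<close>
    have div: "k div n = Suc ((k - n) div n)" "k mod n = (k - n) mod n" if "0 < n" "\<not> k < n"
      for k n :: nat
      using that by (auto simp: le_div_geq le_mod_geq)
    show "block_diag (Suc m) M $$ (i, j) = kronecker (1\<^sub>m (Suc m)) M $$ (i, j)"
      unfolding S kronecker_one_index[OF M ij] using M K ij pos
      by (cases "i < r"; cases "j < c")
         (auto simp: K_def kronecker_one_index[OF M] div simp del: div_eq_0_iff)
  qed (use S M K in \<open>auto simp: kronecker_def\<close>)
qed

text \<open>Row \<open>i * r + a\<close> of the product vanishes outside block column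
  \<open>i\<close>, where it carries row \<open>a\<close> of \<open>M\<close>. Summing over the
  columns one block at a time therefore leaves a single block.\<close>

lemma block_kronecker_one_mult:
  assumes M: "M \<in> carrier_mat r c" and x: "x \<in> carrier_vec (m * c)" and i: "i < m"
  shows "block r (kronecker (1\<^sub>m m) M *\<^sub>v x) i = M *\<^sub>v block c x i"
proof (intro eq_vecI)
  let ?K = "kronecker (1\<^sub>m m) M"
  have K: "?K \<in> carrier_mat (m * r) (m * c)" by (rule kronecker_one_carrier[OF M])
  fix a assume "a < dim_vec (M *\<^sub>v block c x i)"
  then have a: "a < r" using M by simp
  let ?p = "i * r + a"
  have p: "?p < m * r" using a i by (rule block_position_less[rotated])
  have inner: "(\<Sum>q = k * c..<k * c + c. ?K $$ (?p, q) * x $ q) =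
      (if k = i then \<Sum>b<c. M $$ (a, b) * x $ (i * c + b) else 0)" if k: "k < m" for k
  proof -
    have "(\<Sum>q = k * c..<k * c + c. ?K $$ (?p, q) * x $ q) =
        (\<Sum>b = 0..<c. ?K $$ (?p, b + k * c) * x $ (b + k * c))"
      using sum.shift_bounds_nat_ivl[of "\<lambda>q. ?K $$ (?p, q) * x $ q" 0 "k * c" c]
      by (simp add: add.commute)
    also have "\<dots> = (\<Sum>b<c. if k = i then M $$ (a, b) * x $ (i * c + b) else 0)"
    proof (intro sum.cong)
      fix b assume "b \<in> {..<c}"
      then have b: "b < c" by simp
      have q: "b + k * c < m * c" using block_position_less[OF k b] by (simp add: add.commute)
      show "?K $$ (?p, b + k * c) * x $ (b + k * c) =
          (if k = i then M $$ (a, b) * x $ (i * c + b) else 0)"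
        unfolding kronecker_one_index[OF M p q] using a b by (simp add: add.commute)
    qed (simp add: lessThan_atLeast0)
    finally show ?thesis by simp
  qed
  have "(?K *\<^sub>v x) $ ?p = (\<Sum>q<m * c. ?K $$ (?p, q) * x $ q)"
    using K p x by (simp add: scalar_prod_def lessThan_atLeast0)
  \<comment> \<open>The \<open>m * c\<close> columns are cut into \<open>m\<close> consecutive
    intervals of length \<open>c\<close>; \<open>inner\<close> evaluates each of them.\<close>
  also have "\<dots> = (\<Sum>k<m. \<Sum>q = k * c..<k * c + c. ?K $$ (?p, q) * x $ q)"
    by (rule sum.nat_group[symmetric])
  also have "\<dots> = (\<Sum>b<c. M $$ (a, b) * x $ (i * c + b))"
    using i by (simp add: inner)
  also have "\<dots> = (M *\<^sub>v block c x i) $ a"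
    using M a by (simp add: scalar_prod_def lessThan_atLeast0)
  finally show "block r (?K *\<^sub>v x) i $ a = (M *\<^sub>v block c x i) $ a" using a by simp
qed (use M in auto)

section \<open>Appended zero columns\<close>

lemma append_zero_cols_carrier:
  assumes "M \<in> carrier_mat a b"
  shows "append_zero_cols M n \<in> carrier_mat a (b + n)"
  using assms by (auto simp: append_zero_cols_def)

text \<open>Zero columns stay zero under left multiplication. The encoding contains
  \<open>[BB * H 0]\<close> and the dual equation \<open>[H 0]\<close>; pulling out the left factor
  reconciles the two.\<close>

lemma append_zero_cols_mult:
  assumes K: "K \<in> carrier_mat r a" and M: "M \<in> carrier_mat a b"
  shows "append_zero_cols (K * M) n = K * append_zero_cols M n"
proof (intro eq_matI)
  fix i j
  assume "i < dim_row (K * append_zero_cols M n)" "j < dim_col (K * append_zero_cols M n)"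
  then have ij: "i < r" "j < b + n"
    using K append_zero_cols_carrier[OF M, of n] by auto
  have "col (append_zero_cols M n) j = (if j < b then col M j else 0\<^sub>v a)"
    using M ij by (intro eq_vecI) (auto simp: append_zero_cols_def)
  then show "append_zero_cols (K * M) n $$ (i, j) = (K * append_zero_cols M n) $$ (i, j)"
    using K M ij append_zero_cols_carrier[OF M, of n] by (auto simp: append_zero_cols_def)
qed (use K M in \<open>auto simp: append_zero_cols_def\<close>)

section \<open>Duality bounds for the rows of the encoding\<close>

lemma weak_duality:
  fixes W :: "real mat"
  assumes W: "W \<in> carrier_mat nv n" and l: "l \<in> carrier_vec nv" "0\<^sub>v nv \<le> l"
    and w: "w \<in> polyhedron W v"
  shows "(transpose_mat W *\<^sub>v l) \<bullet> w \<le> v \<bullet> l"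
proof -
  have wc: "w \<in> carrier_vec n" and le: "W *\<^sub>v w \<le> v" using w W by (auto simp: polyhedron_def)
  \<comment> \<open>The order on vectors includes equality of dimensions.\<close>
  have v: "dim_vec v = nv" using le W by (simp add: less_eq_vec_def)
  have "(transpose_mat W *\<^sub>v l) \<bullet> w = l \<bullet> (W *\<^sub>v w)"
    using transpose_vec_mult_scalar[OF W wc l(1)] .
  also have "\<dots> = (\<Sum>k<nv. l $ k * (W *\<^sub>v w) $ k)"
    using W by (simp add: scalar_prod_def lessThan_atLeast0)
  \<comment> \<open>Each inequality of the polyhedron is weighted by a multiplier
    \<open>l $ k\<close>, which is nonnegative.\<close>
  also have "\<dots> \<le> (\<Sum>k<nv. l $ k * v $ k)"
    using l le v by (intro sum_mono mult_left_mono) (auto simp: less_eq_vec_def)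
  also have "\<dots> = v \<bullet> l"
    using l by (simp add: scalar_prod_def lessThan_atLeast0 mult.commute)
  finally show ?thesis .
qed

lemma mat_of_single_col_transpose_mult:
  fixes v l :: "real vec"
  assumes "v \<in> carrier_vec n"
  shows "(transpose_mat (mat_of_cols n [v]) *\<^sub>v l) $ 0 = v \<bullet> l"
  using assms by simp

text \<open>Block \<open>i\<close> of the dual equation identifies \<open>transpose_mat W\<close>
  times the \<open>i\<close>-th block of \<open>l\<close> with the coefficient vector of
  \<open>w\<close> in row \<open>i\<close>. The resulting bound, \<open>v\<close> times that block
  of \<open>l\<close>, is entry \<open>i\<close> of the right-hand side.\<close>

lemma encoding_rows_bounded:
  fixes GH BB H Gw W :: "real mat"
  assumes GH: "GH \<in> carrier_mat m p" and BB: "BB \<in> carrier_mat p q" and H: "H \<in> carrier_mat q b"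
    and Gw: "Gw \<in> carrier_mat m (b + nw)" and W: "W \<in> carrier_mat nv (b + nw)"
    and v: "v \<in> carrier_vec nv"
    and l: "l \<in> carrier_vec (m * nv)" "0\<^sub>v (m * nv) \<le> l"
    and dual: "transpose_mat (block_diag m W) *\<^sub>v l =
      kronecker (1\<^sub>m m) (transpose_mat (append_zero_cols H nw)) *\<^sub>v concat_rows (GH * BB)
        + concat_rows Gw"
    and w: "w \<in> polyhedron W v"
  shows "(GH * append_zero_cols (BB * H) nw + Gw) *\<^sub>v w
    \<le> transpose_mat (block_diag m (mat_of_cols nv [v])) *\<^sub>v l"
proof -
  let ?H0 = "append_zero_cols H nw" and ?F = "GH * BB" and ?V = "mat_of_cols nv [v]"
  let ?n = "b + nw"
  have H0: "?H0 \<in> carrier_mat q ?n" by (rule append_zero_cols_carrier[OF H])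
  have F: "?F \<in> carrier_mat m q" using GH BB by simp
  have V: "?V \<in> carrier_mat nv 1" by (intro carrier_matI) auto
  have wc: "w \<in> carrier_vec ?n" using w W by (simp add: polyhedron_def)
  have lhs: "GH * append_zero_cols (BB * H) nw = ?F * ?H0"
    using GH BB H0 by (simp add: append_zero_cols_mult[OF BB H])
  have Vdim: "dim_row (transpose_mat (block_diag m ?V)) = m"
    by (simp add: block_diag_eq_kronecker[OF V] kronecker_def)
  have "((?F * ?H0 + Gw) *\<^sub>v w) $ i \<le> (transpose_mat (block_diag m ?V) *\<^sub>v l) $ i"
    if i: "i < m" for i
  proof -
    \<comment> \<open>Applied with \<open>M = W\<close> to the dual equation, and with the single
      column \<open>v\<close>, where \<open>c = 1\<close>, to the bound.\<close>
    have blocks: "transpose_mat M *\<^sub>v block nv l i = block c (transpose_mat (block_diag m M) *\<^sub>v l) i"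
      if "M \<in> carrier_mat nv c" for M c
      using that l i
      by (simp add: block_diag_eq_kronecker transpose_kronecker_one block_kronecker_one_mult)
    have "transpose_mat W *\<^sub>v block nv l i = transpose_mat ?H0 *\<^sub>v row ?F i + row Gw i"
      unfolding blocks[OF W] dual
      using H0 F Gw i
      by (simp add: block_add[OF concat_rows_carrier[OF Gw]] block_concat_rows[OF Gw]
          block_concat_rows[OF F] block_kronecker_one_mult[OF _ concat_rows_carrier[OF F]])
    \<comment> \<open>Moving \<open>?H0\<close> to the other side of the scalar product exhibits row
      \<open>i\<close> as a linear form in \<open>w\<close> with the same coefficients.\<close>
    moreover have "((?F * ?H0 + Gw) *\<^sub>v w) $ i = (transpose_mat ?H0 *\<^sub>v row ?F i + row Gw i) \<bullet> w"
    proof -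
      have "((?F * ?H0 + Gw) *\<^sub>v w) $ i = (?F *\<^sub>v (?H0 *\<^sub>v w)) $ i + (Gw *\<^sub>v w) $ i"
        using F H0 Gw wc i by (simp add: add_mult_distrib_mat_vec[of _ m ?n])
      also have "(?F *\<^sub>v (?H0 *\<^sub>v w)) $ i = row ?F i \<bullet> (?H0 *\<^sub>v w)" using GH i by simp
      also have "\<dots> = (transpose_mat ?H0 *\<^sub>v row ?F i) \<bullet> w"
        using transpose_vec_mult_scalar[OF H0 wc row_carrier_vec[OF i F]] by simp
      finally show ?thesis
        using F H0 Gw wc i by (simp add: add_scalar_prod_distrib[of _ ?n])
    qed
    ultimately have "((?F * ?H0 + Gw) *\<^sub>v w) $ i = (transpose_mat W *\<^sub>v block nv l i) \<bullet> w" by simp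
    also have "\<dots> \<le> v \<bullet> block nv l i"
      by (rule weak_duality[OF W _ block_nonneg[OF l(2) i] w]) simp
    \<comment> \<open>Blocks of length 1 are entries: position 0 of block \<open>i\<close> is
      position \<open>i\<close>.\<close>
    also have "\<dots> = block 1 (transpose_mat (block_diag m ?V) *\<^sub>v l) i $ 0"
      unfolding blocks[OF V, symmetric] mat_of_single_col_transpose_mult[OF v] ..
    finally show ?thesis by simp
  qed
  then show ?thesis using Vdim Gw by (simp add: lhs less_eq_vec_def)
qed

theorem theorem1:
  fixes N nx nu nw nv nc nb m mphi :: nat
    and A B W GH Gw G\<theta> G\<delta> :: "real mat"
    and v g \<theta> :: "real vec"
    and Px Pw :: "nat \<Rightarrow> real mat" and \<rho> :: "nat \<Rightarrow> real vec" and r :: "nat \<Rightarrow> nat"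
    and Uin X :: "real vec set"
    and \<phi> :: formula
    and J :: "real mat \<Rightarrow> real vec \<Rightarrow> real"
  defines "AA \<equiv> stacked_A N nx A"
    and "BB \<equiv> stacked_B N nx nu A B"
    and "Wset \<equiv> polyhedron W v"
    and "C \<equiv> constraints N nx nu nw A B Uin X (\<lambda>i. prop_polyhedron (Px i) (Pw i) (\<rho> i)) \<phi>"
  assumes horizon: "N \<ge> 1"
    and system: "A \<in> carrier_mat nx nx" "B \<in> carrier_mat nx nu"
    and disturbance: "W \<in> carrier_mat nv ((N + 1) * nw)" "v \<in> carrier_vec nv"
      "closed_vecs ((N + 1) * nw) Wset" "bounded_vecs Wset"
    and objective: "convex_quadratic (N * nu) (N * nw) J"
    and formula_props: "props \<phi> \<subseteq> {1..m}"
      "\<forall>i\<in>{1..m}. Px i \<in> carrier_mat (r i) nx \<and> Pw i \<in> carrier_mat (r i) nw \<and> \<rho> i \<in> carrier_vec (r i)"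
    and input_set: "compact_convex_polyhedron nu Uin"
    and state_set: "compact_convex_polyhedron nx X"
    and encoding_dims: "GH \<in> carrier_mat mphi ((N + 1) * nx)" "Gw \<in> carrier_mat mphi ((N + 1) * nw)"
      "G\<theta> \<in> carrier_mat mphi ((N + 1) * nx)" "G\<delta> \<in> carrier_mat mphi (nc + nb)" "g \<in> carrier_vec mphi"
    and encoding: "\<forall>H \<in> causal_gains N nu nw. \<forall>h \<in> carrier_vec (N * nu).
      \<forall>\<theta>' \<in> carrier_vec nx. \<forall>w \<in> Wset.
        C H h \<theta>' w \<longleftrightarrow>
        (\<exists>\<delta> \<in> mixed_binary nc nb. encoding nw AA BB GH Gw G\<theta> G\<delta> g H h \<theta>' w \<delta> \<le> 0\<^sub>v mphi)"
    and initial_state: "\<theta> \<in> carrier_vec nx"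
  defines "P \<equiv> robust_program N nu nw J Wset (\<lambda>H h w. C H h \<theta> w)"
    and "Q \<equiv> dual_program N nu nw J W v nc nb AA BB GH Gw G\<theta> G\<delta> g \<theta>"
  shows "(\<forall>H h \<delta> l. is_optimal Q (H, h, \<delta>, l) \<longrightarrow> is_feasible P (H, h)) \<and>
         (\<forall>H h \<delta> l. is_feasible Q (H, h, \<delta>, l) \<longrightarrow> is_feasible P (H, h))"
proof -
  have feasible: "is_feasible P (H, h)" if "is_feasible Q (H, h, \<delta>, l)" for H h \<delta> l
  proof -
    have dims: "dim_row GH = mphi" "dim_vec v = nv" using encoding_dims disturbance by auto
    let ?Vl = "transpose_mat (block_diag mphi (mat_of_cols nv [v])) *\<^sub>v l"
    have H: "H \<in> causal_gains N nu nw" and h: "h \<in> carrier_vec (N * nu)"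
      and \<delta>: "\<delta> \<in> mixed_binary nc nb"
      and l: "l \<in> carrier_vec (mphi * nv)" "0\<^sub>v (mphi * nv) \<le> l"
      and primal: "?Vl + (GH * BB) *\<^sub>v h + (G\<theta> * AA) *\<^sub>v \<theta> + G\<delta> *\<^sub>v \<delta> + g \<le> 0\<^sub>v mphi"
      and dual: "transpose_mat (block_diag mphi W) *\<^sub>v l =
        kronecker (1\<^sub>m mphi) (transpose_mat (append_zero_cols H nw)) *\<^sub>v concat_rows (GH * BB)
          + concat_rows Gw"
      using that by (auto simp: Q_def is_feasible_def dual_program_def Let_def dims)
    have Hc: "H \<in> carrier_mat (N * nu) (N * nw)" using H by (simp add: causal_gains_def)
    have BB: "BB \<in> carrier_mat ((N + 1) * nx) (N * nu)" by (simp add: BB_def stacked_B_def)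
    \<comment> \<open>The last \<open>nw\<close> columns are the zero block of the policy: the final
      disturbance does not enter the inputs.\<close>
    have ncols: "(N + 1) * nw = N * nw + nw" by simp
    have "C H h \<theta> w" if w: "w \<in> Wset" for w
    proof -
      have "(GH * append_zero_cols (BB * H) nw + Gw) *\<^sub>v w \<le> ?Vl"
        using encoding_rows_bounded[OF encoding_dims(1) BB Hc encoding_dims(2)[unfolded ncols]
            disturbance(1)[unfolded ncols] disturbance(2) l dual w[unfolded Wset_def]] .
      \<comment> \<open>The part of the encoding that depends on \<open>w\<close> is replaced by its
        bound \<open>?Vl\<close>; the other terms agree with those in \<open>primal\<close>.\<close>
      then have "encoding nw AA BB GH Gw G\<theta> G\<delta> g H h \<theta> w \<delta> \<le> 0\<^sub>v mphi"
        using primal encoding_dims by (fastforce simp: encoding_def less_eq_vec_def)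
      then show ?thesis using encoding H h initial_state w \<delta> by blast
    qed
    then show ?thesis using H h by (simp add: P_def is_feasible_def robust_program_def)
  qed
  \<comment> \<open>A minimizer is in particular feasible, so the claim on optimal points follows
    from the one on feasible points.\<close>
  then show ?thesis by (auto simp: is_optimal_def is_arg_min_def)
qed

end
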